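(* Let $E$ be a Banach space over a valued field $(\mathbb{K},|.|)$ and $A\colon E\to E$ be an automorphism of topological vector spaces which is hyperbolic, with associated decomposition $E=E_{\rm s}\oplus E_{\rm u}$. Let $\|.\|\colon E\to[0,\infty[$ be a norm adapted to $A$ and $g\colon E\to E$ be a bounded Lipschitz map such that \[ \operatorname{Lip}(g)<\|A^{-1}\|^{-1},\qquad \|A^{-1}|_{E_{\rm u}}\|\,(1+\operatorname{Lip}(g))<1,\qquad\text{and}\qquad \|A|_{E_{\rm s}}\|+\operatorname{Lip}(g)<1 . \] Then there exists a unique bounded continuous map $v\colon E\to E$ such that \[ (A+g)\circ(\mathrm{id}_E+v)=(\mathrm{id}_E+v)\circ A . \] The map $\mathrm{id}_E+v$ is a homeomorphism from $E$ onto $E$, and both $v$ and $w:=(\mathrm{id}_E+v)^{-1}-\mathrm{id}_E$ are H\"older. Moreover, $w$ is the unique bounded continuous map $w\colon E\to E$ such that \[ A\circ(\mathrm{id}_E+w)=(\mathrm{id}_E+w)\circ(A+g). \] If $g(0)=0$, then also $v(0)=0$.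
   Context: A valued field $(\mathbb{K},|.|)$ is a field $\mathbb{K}$ with an absolute value $|.|\colon\mathbb{K}\to[0,\infty[$ (so $|x|=0$ iff $x=0$, $|xy|=|x||y|$, $|x+y|\le|x|+|y|$) which defines a non-discrete topology on $\mathbb{K}$. A normed space over $(\mathbb{K},|.|)$ has a norm with $\|\lambda x\|=|\lambda|\,\|x\|$; it is a Banach space if it is complete. Hyperbolicity: an automorphism $A\colon E\to E$ of topological vector spaces is hyperbolic if there exist $A$-invariant vector subspaces $E_{\rm s}$ and $E_{\rm u}$ of $E$ with $E=E_{\rm s}\oplus E_{\rm u}$, and a norm $\|.\|$ on $E$ defining its topology, such that $\|x+y\|=\max\{\|x\|,\|y\|\}$ for all $x\in E_{\rm s}$, $y\in E_{\rm u}$, and $\|A|_{E_{\rm s}}\|<1$ and $\|A^{-1}|_{E_{\rm u}}\|<1$ for the operator norms with respect to $\|.\|$. Such a norm is called adapted to $A$. All operator norms, boundedness, Lipschitz and H\"older properties are with respect to the adapted norm $\|.\|$. Operator norm: $\|B\|:=\sup\{\|Bx\|/\|x\|\colon 0\neq x\}$. $\operatorname{Lip}(g)$ is the smallest Lipschitz constant of $g$. A map $f\colon(X,d_X)\to(Y,d_Y)$ is H\"older of exponent $\alpha\in\,]0,\infty[$ if there is $L\in[0,\infty[$ with $d_Y(f(x),f(y))\le L\,d_X(x,y)^\alpha$ for all $x,y\in X$; it is H\"older if it is H\"older of some exponent $\alpha>0$. *)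

theory Defs
  imports "HOL-Analysis.Analysis"
begin

definition norm_metric :: "('a::ab_group_add \<Rightarrow> real) \<Rightarrow> 'a metric"
  where "norm_metric n = metric (UNIV, \<lambda>x y. n (x - y))"

abbreviation norm_topology :: "('a::ab_group_add \<Rightarrow> real) \<Rightarrow> 'a topology"
  where "norm_topology n \<equiv> mtopology_of (norm_metric n)"

locale valued_field =
  fixes absv :: "'k::field \<Rightarrow> real"
  assumes absv_nonneg: "0 \<le> absv a"
    and absv_eq_0_iff: "absv a = 0 \<longleftrightarrow> a = 0"
    and absv_mult: "absv (a * b) = absv a * absv b"
    and absv_triangle: "absv (a + b) \<le> absv a + absv b"
    and not_discrete: "norm_topology absv \<noteq> discrete_topology UNIV"

locale valued_normed_space = valued_field absv + vector_space smul
  for absv :: "'k::field \<Rightarrow> real" and smul :: "'k \<Rightarrow> 'e::ab_group_add \<Rightarrow> 'e" +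
  fixes nrm :: "'e \<Rightarrow> real"
  assumes nrm_nonneg: "0 \<le> nrm x"
    and nrm_eq_0_iff: "nrm x = 0 \<longleftrightarrow> x = 0"
    and nrm_scale: "nrm (smul a x) = absv a * nrm x"
    and nrm_triangle: "nrm (x + y) \<le> nrm x + nrm y"

locale valued_banach_space = valued_normed_space +
  assumes complete: "mcomplete_of (norm_metric nrm)"

text \<open>
  The function \<^const>\<open>metric\<close> is only meaningful on actual metrics; the following
  lemmas show that it is applied to a metric above.
\<close>

lemma (in valued_field) Metric_space_absv: "Metric_space UNIV (\<lambda>a b. absv (a - b))"
proof
  have m1: "absv (- 1) = 1"
  proof -
    have "absv 1 * absv 1 = absv 1" "absv (- 1) * absv (- 1) = absv 1"
      using absv_mult[of 1 1] absv_mult[of "- 1" "- 1"] by simp_all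
    moreover have "absv 1 \<noteq> 0" by (simp add: absv_eq_0_iff)
    ultimately have "absv (- 1) ^ 2 = 1 ^ 2" by (simp add: power2_eq_square)
    then show ?thesis using absv_nonneg[of "- 1"] power2_eq_imp_eq by fastforce
  qed
  show "absv (a - b) = absv (b - a)" for a b
    using absv_mult[of "- 1" "a - b"] by (simp add: m1)
  show "absv (a - c) \<le> absv (a - b) + absv (b - c)" for a b c
    using absv_triangle[of "a - b" "b - c"] by simp
qed (auto simp: absv_nonneg absv_eq_0_iff)

lemma (in valued_normed_space) Metric_space_nrm: "Metric_space UNIV (\<lambda>x y. nrm (x - y))"
proof
  have m1: "absv (- 1) = 1"
    using Metric_space.commute[OF Metric_space_absv, of 0 1] absv_mult[of 1 1]
      absv_eq_0_iff[of 1] by simp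
  show "nrm (x - y) = nrm (y - x)" for x y
    using nrm_scale[of "- 1" "x - y"] by (simp add: m1)
  show "nrm (x - z) \<le> nrm (x - y) + nrm (y - z)" for x y z
    using nrm_triangle[of "x - y" "y - z"] by simp
qed (auto simp: nrm_nonneg nrm_eq_0_iff)

text \<open>
  Operator norms and Lipschitz constants take values in \<open>[0, \<infinity>]\<close>. In particular the operator
  norm on the zero subspace is \<open>0\<close>, its inverse is \<open>\<infinity>\<close>, and the operator norm of an unbounded
  operator is \<open>\<infinity>\<close>.
\<close>

definition opnorm_on :: "('e::ab_group_add \<Rightarrow> real) \<Rightarrow> 'e set \<Rightarrow> ('e \<Rightarrow> 'e) \<Rightarrow> ennreal"
  where "opnorm_on n F B = (SUP x\<in>F - {0}. ennreal (n (B x) / n x))"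

definition Lip :: "('e::ab_group_add \<Rightarrow> real) \<Rightarrow> ('e \<Rightarrow> 'e) \<Rightarrow> ennreal"
  where "Lip n f = (INF L\<in>{L. 0 \<le> L \<and> (\<forall>x y. n (f x - f y) \<le> L * n (x - y))}. ennreal L)"

definition holder :: "('e::ab_group_add \<Rightarrow> real) \<Rightarrow> ('e \<Rightarrow> 'e) \<Rightarrow> bool"
  where "holder n f \<longleftrightarrow>
    (\<exists>\<alpha>>0. \<exists>L\<ge>0. \<forall>x y. n (f x - f y) \<le> L * n (x - y) powr \<alpha>)"

definition bounded_map :: "('e \<Rightarrow> real) \<Rightarrow> ('e \<Rightarrow> 'e) \<Rightarrow> bool"
  where "bounded_map n f \<longleftrightarrow> bdd_above (range (\<lambda>x. n (f x)))"

definition tvs_automorphism ::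
    "('k::field \<Rightarrow> 'e::ab_group_add \<Rightarrow> 'e) \<Rightarrow> 'e topology \<Rightarrow> ('e \<Rightarrow> 'e) \<Rightarrow> bool"
  where "tvs_automorphism smul T A \<longleftrightarrow>
    Vector_Spaces.linear smul smul A \<and> homeomorphic_map T T A"

text \<open>
  Since \<open>A\<close> is bijective, the inclusions \<open>A ` Es \<subseteq> Es\<close> and \<open>A ` Eu \<subseteq> Eu\<close> are equalities
  for complementary subspaces \<open>Es\<close> and \<open>Eu\<close>, so \<open>Eu\<close> is also invariant under \<open>inv A\<close>.
\<close>

definition adapted_norm ::
    "('k::field \<Rightarrow> real) \<Rightarrow> ('k \<Rightarrow> 'e::ab_group_add \<Rightarrow> 'e) \<Rightarrow> 'e topology \<Rightarrow> ('e \<Rightarrow> 'e)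
      \<Rightarrow> 'e set \<Rightarrow> 'e set \<Rightarrow> ('e \<Rightarrow> real) \<Rightarrow> bool"
  where "adapted_norm absv smul T A Es Eu n \<longleftrightarrow>
    module.subspace smul Es \<and> module.subspace smul Eu \<and>
    A ` Es \<subseteq> Es \<and> A ` Eu \<subseteq> Eu \<and>
    Es \<inter> Eu = {0} \<and> (\<forall>z. \<exists>x\<in>Es. \<exists>y\<in>Eu. z = x + y) \<and>
    valued_normed_space absv smul n \<and> norm_topology n = T \<and>
    (\<forall>x\<in>Es. \<forall>y\<in>Eu. n (x + y) = max (n x) (n y)) \<and>
    opnorm_on n Es A < 1 \<and> opnorm_on n Eu (inv A) < 1"

definition hyperbolic ::
    "('k::field \<Rightarrow> real) \<Rightarrow> ('k \<Rightarrow> 'e::ab_group_add \<Rightarrow> 'e) \<Rightarrow> 'e topology \<Rightarrow> ('e \<Rightarrow> 'e) \<Rightarrow> bool"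
  where "hyperbolic absv smul T A \<longleftrightarrow>
    tvs_automorphism smul T A \<and> (\<exists>Es Eu n. adapted_norm absv smul T A Es Eu n)"

definition bounded_semiconjugacy ::
    "'e topology \<Rightarrow> ('e::ab_group_add \<Rightarrow> real) \<Rightarrow> ('e \<Rightarrow> 'e) \<Rightarrow> ('e \<Rightarrow> 'e) \<Rightarrow> ('e \<Rightarrow> 'e) \<Rightarrow> bool"
  where "bounded_semiconjugacy T n P Q v \<longleftrightarrow>
    bounded_map n v \<and> continuous_map T T v \<and>
    P \<circ> (\<lambda>x. x + v x) = (\<lambda>x. x + v x) \<circ> Q"

end

theory Submission imports Defs begin

text \<open>
  Given perturbations \<open>g1\<close>, \<open>g2\<close> of \<open>A\<close>, the equation
  \<open>(A + g1) \<circ> (id + v) = (id + v) \<circ> (A + g2)\<close> is a fixed point equation for a contraction of the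
  bounded maps \<open>v\<close> in the supremum norm. This contraction preserves a ball of a suitable Hoelder
  space whose exponent is so small that composing with \<open>A + g2\<close> or its inverse does not destroy the
  contraction factor, so the unique bounded solution is Hoelder. The pairs \<open>(g, 0)\<close> and \<open>(0, g)\<close>
  yield \<open>v\<close> and \<open>w\<close>; uniqueness for \<open>(0, 0)\<close> and \<open>(g, g)\<close> shows that \<open>id + v\<close> and \<open>id + w\<close> are
  inverse to each other.
\<close>

subsection \<open>Contractions of families in a complete normed group\<close>

text \<open>A norm on an abelian group, without scalars: the fixed point argument works with
  additivity and Lipschitz estimates alone.\<close>

locale group_norm =
  fixes nrm :: "'e::ab_group_add \<Rightarrow> real"
  assumes nrm_nonneg [simp]: "0 \<le> nrm x"
    and nrm_eq_0_iff [simp]: "nrm x = 0 \<longleftrightarrow> x = 0"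
    and nrm_minus [simp]: "nrm (- x) = nrm x"
    and nrm_triangle: "nrm (x + y) \<le> nrm x + nrm y"
begin

lemma nrm_0 [simp]: "nrm 0 = 0"
  by simp

lemma nrm_minus_commute: "nrm (x - y) = nrm (y - x)"
  by (metis minus_diff_eq nrm_minus)

lemma nrm_triangle_diff: "nrm (x - y) \<le> nrm x + nrm y"
  using nrm_triangle[of x "- y"] by simp

lemma nrm_triangle_via: "nrm (x - z) \<le> nrm (x - y) + nrm (y - z)"
  using nrm_triangle[of "x - y" "y - z"] by simp

lemma nrm_add_diff: "nrm ((x + y) - (x' + y')) \<le> nrm (x - x') + nrm (y - y')"
  using nrm_triangle[of "x - x'" "y - y'"] by (simp add: algebra_simps)

lemma nrm_diff_diff: "nrm ((x - y) - (x' - y')) \<le> nrm (x - x') + nrm (y - y')"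
  using nrm_triangle_diff[of "x - x'" "y - y'"] by (simp add: algebra_simps)

sublocale Metric_space UNIV "\<lambda>x y. nrm (x - y)"
  by standard (auto simp: nrm_minus_commute nrm_triangle_via)

lemma mtopology_eq: "mtopology = norm_topology nrm"
  by (simp add: norm_metric_def)

lemma mcomplete_eq: "mcomplete = mcomplete_of (norm_metric nrm)"
  by (simp add: norm_metric_def)

lemma nrm_limit_le:
  assumes "(\<lambda>k. nrm (u k - l)) \<longlonglongrightarrow> 0" and "\<And>k. k \<ge> N \<Longrightarrow> nrm (u k - z) \<le> c"
  shows "nrm (l - z) \<le> c"
proof -
  have "(\<lambda>k. nrm (u k - l) + c) \<longlonglongrightarrow> 0 + c"
    by (intro tendsto_add assms tendsto_const)
  moreover have "nrm (l - z) \<le> nrm (u k - l) + c" if "k \<ge> N" for k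
    using nrm_triangle_via[of l z "u k"] assms(2)[OF that] by (simp add: nrm_minus_commute)
  ultimately show ?thesis
    using LIMSEQ_le_const by fastforce
qed

text \<open>Banach's fixed point theorem for the supremum distance, without building a space of
  bounded maps: \<open>D\<close> is any pointwise bound on the distance, and \<open>X\<close> is
  closed under pointwise limits. The index type \<open>unit\<close> turns families into points; the
  index type \<open>'e\<close> turns them into self-maps.\<close>

lemma uniform_contraction_fixpoint:
  fixes \<Phi> :: "('i \<Rightarrow> 'e) \<Rightarrow> 'i \<Rightarrow> 'e"
  assumes complete: mcomplete
    and c: "0 \<le> c" "c < 1"
    and v0: "v0 \<in> X" and \<Phi>: "\<And>v. v \<in> X \<Longrightarrow> \<Phi> v \<in> X"
    and contr: "\<And>u v D x. \<lbrakk>\<And>x. nrm (u x - v x) \<le> D\<rbrakk> \<Longrightarrow> nrm (\<Phi> u x - \<Phi> v x) \<le> c * D"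
    and start: "\<And>x. nrm (\<Phi> v0 x - v0 x) \<le> D0"
    and closed: "\<And>u v. \<lbrakk>\<And>k. u k \<in> X; \<And>x. (\<lambda>k. nrm (u k x - v x)) \<longlonglongrightarrow> 0\<rbrakk> \<Longrightarrow> v \<in> X"
  shows "\<exists>v\<in>X. \<Phi> v = v"
proof -
  define u where "u k = (\<Phi> ^^ k) v0" for k
  have u_Suc: "u (Suc k) = \<Phi> (u k)" for k
    by (simp add: u_def)
  have uX: "u k \<in> X" for k
    by (induction k) (auto simp: u_def v0 \<Phi>)
  have D0: "0 \<le> D0"
    using start nrm_nonneg order_trans by blast
  have step: "nrm (u (Suc k) x - u k x) \<le> D0 * c ^ k" for k x
  proof (induction k arbitrary: x)
    case 0
    then show ?case using start by (simp add: u_def)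
  next
    case (Suc k)
    then show ?case
      using contr[of "u (Suc k)" "u k" "D0 * c ^ k"] by (simp add: u_Suc mult_ac)
  qed
  \<comment> \<open>\<open>E\<close> is the sum of the geometric series \<open>D0 * c ^ k\<close>.
    Bounding by its exact partial sums \<open>E * (c ^ k - c ^ m)\<close> lets the induction on
    \<open>m\<close> telescope.\<close>
  define E where "E = D0 / (1 - c)"
  have E: "0 \<le> E" "D0 = E * (1 - c)"
    using c D0 by (auto simp: E_def)
  have tail: "nrm (u m x - u k x) \<le> E * (c ^ k - c ^ m)" if "k \<le> m" for k m x
    using that
  proof (induction m rule: dec_induct)
    case (step m)
    have "nrm (u (Suc m) x - u k x) \<le> D0 * c ^ m + E * (c ^ k - c ^ m)"
      using nrm_triangle_via[of "u (Suc m) x" "u k x" "u m x"] \<open>nrm (u (Suc m) x - u m x) \<le> D0 * c ^ m\<close> step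
      by linarith
    also have "\<dots> = E * (c ^ k - c ^ Suc m)"
      unfolding E(2) by (simp add: algebra_simps)
    finally show ?case .
  qed simp
  have tail': "nrm (u m x - u k x) \<le> E * c ^ k" if "k \<le> m" for k m x
    using tail[OF that, of x] mult_left_mono[of "c ^ k - c ^ m" "c ^ k" E] E c by force
  have pow0: "(\<lambda>k. E * c ^ k) \<longlonglongrightarrow> 0"
    using c by (intro tendsto_mult_right_zero LIMSEQ_power_zero) auto
  have "\<exists>l. (\<lambda>k. nrm (u k x - l)) \<longlonglongrightarrow> 0" for x
  proof -
    have "MCauchy (\<lambda>k. u k x)"
      unfolding MCauchy_def
    proof safe
      fix \<epsilon> :: real assume "0 < \<epsilon>"
      then obtain N where N: "\<And>k. k \<ge> N \<Longrightarrow> E * c ^ k < \<epsilon>"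
        using order_tendstoD(2)[OF pow0] unfolding eventually_sequentially by blast
      have "nrm (u m x - u k x) < \<epsilon>" if "N \<le> k" "k \<le> m" for k m
        using tail'[OF that(2), of x] N[OF that(1)] by simp
      then have "\<forall>n n'. N \<le> n \<longrightarrow> N \<le> n' \<longrightarrow> nrm (u n x - u n' x) < \<epsilon>"
        by (metis nle_le nrm_minus_commute)
      then show "\<exists>N. \<forall>n n'. N \<le> n \<longrightarrow> N \<le> n' \<longrightarrow> nrm (u n x - u n' x) < \<epsilon>" ..
    qed auto
    then show ?thesis
      using complete by (auto simp: mcomplete_def limitin_metric_dist_null)
  qed
  then obtain v where v: "\<And>x. (\<lambda>k. nrm (u k x - v x)) \<longlonglongrightarrow> 0"
    by metis
  have uv: "nrm (u k x - v x) \<le> E * c ^ k" for k x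
    using nrm_limit_le[OF v tail'] nrm_minus_commute by metis
  have "\<Phi> v x = v x" for x
  proof -
    \<comment> \<open>Both \<open>\<Phi> v\<close> and \<open>v\<close> lie within
      \<open>c * (E * c ^ k)\<close> of the iterate \<open>u (Suc k)\<close>.\<close>
    have "nrm (\<Phi> v x - v x) \<le> 2 * c * (E * c ^ k)" for k
    proof -
      have "nrm (\<Phi> v x - u (Suc k) x) \<le> c * (E * c ^ k)"
        unfolding u_Suc using uv by (intro contr) (simp add: nrm_minus_commute)
      then show ?thesis
        using nrm_triangle_via[of "\<Phi> v x" "v x" "u (Suc k) x"] uv[of "Suc k" x]
        by (simp add: algebra_simps)
    qed
    moreover have "(\<lambda>k. 2 * c * (E * c ^ k)) \<longlonglongrightarrow> 0"
      by (intro tendsto_mult_right_zero pow0)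
    ultimately have "nrm (\<Phi> v x - v x) \<le> 0"
      by (meson LIMSEQ_le_const)
    then show ?thesis
      by (metis antisym nrm_eq_0_iff nrm_nonneg eq_iff_diff_eq_0)
  qed
  moreover have "v \<in> X"
    using closed uX v by blast
  ultimately show ?thesis by auto
qed

section \<open>Continuity in the norm topology\<close>

lemma continuous_map_nrm_iff:
  "continuous_map mtopology mtopology f \<longleftrightarrow>
    (\<forall>a. \<forall>\<epsilon>>0. \<exists>\<delta>>0. \<forall>x. nrm (a - x) < \<delta> \<longrightarrow> nrm (f a - f x) < \<epsilon>)"
  by (simp add: metric_continuous_map[OF Metric_space_axioms])

lemma continuous_map_if_holder:
  assumes "holder nrm f"
  shows "continuous_map mtopology mtopology f"
proof -
  obtain \<alpha> C where \<alpha>: "\<alpha> > 0" "C \<ge> 0" and C: "\<And>x y. nrm (f x - f y) \<le> C * nrm (x - y) powr \<alpha>"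
    using assms unfolding holder_def by blast
  have "\<exists>\<delta>>0. \<forall>x. nrm (a - x) < \<delta> \<longrightarrow> nrm (f a - f x) < \<epsilon>" if "\<epsilon> > 0" for a \<epsilon>
  proof -
    \<comment> \<open>\<open>\<delta>\<close> solves
      \<open>(C + 1) * \<delta> powr \<alpha> = \<epsilon>\<close>; adding 1 avoids division by zero
      and makes the final inequality strict.\<close>
    define \<delta> where "\<delta> = (\<epsilon> / (C + 1)) powr (1 / \<alpha>)"
    have "nrm (f a - f x) < \<epsilon>" if "nrm (a - x) < \<delta>" for x
    proof -
      have "nrm (a - x) powr \<alpha> \<le> \<delta> powr \<alpha>"
        using \<alpha> that by (intro powr_mono2) auto
      also have "\<delta> powr \<alpha> = \<epsilon> / (C + 1)"
        using \<alpha> \<open>\<epsilon> > 0\<close> by (simp add: \<delta>_def powr_powr)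
      finally have "nrm (f a - f x) \<le> C * (\<epsilon> / (C + 1))"
        using C[of a x] mult_left_mono[OF _ \<alpha>(2)] order_trans by blast
      also have "\<dots> < \<epsilon>"
        using \<alpha> \<open>\<epsilon> > 0\<close> by (simp add: field_simps)
      finally show ?thesis .
    qed
    moreover have "\<delta> > 0"
      using \<alpha> \<open>\<epsilon> > 0\<close> by (simp add: \<delta>_def)
    ultimately show ?thesis by blast
  qed
  then show ?thesis
    by (simp add: continuous_map_nrm_iff)
qed

lemma continuous_map_add:
  assumes "continuous_map mtopology mtopology f" "continuous_map mtopology mtopology h"
  shows "continuous_map mtopology mtopology (\<lambda>x. f x + h x)"
  unfolding continuous_map_nrm_iff
proof safe
  fix a \<epsilon> assume "(\<epsilon>::real) > 0"
  then have "\<epsilon> / 2 > 0"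
    by simp
  then have "\<exists>\<delta>>0. \<forall>x. nrm (a - x) < \<delta> \<longrightarrow> nrm (f a - f x) < \<epsilon> / 2"
    "\<exists>\<delta>>0. \<forall>x. nrm (a - x) < \<delta> \<longrightarrow> nrm (h a - h x) < \<epsilon> / 2"
    using assms by (auto simp only: continuous_map_nrm_iff)
  then obtain \<delta>1 \<delta>2 where \<delta>: "\<delta>1 > 0" "\<delta>2 > 0"
    "\<And>x. nrm (a - x) < \<delta>1 \<Longrightarrow> nrm (f a - f x) < \<epsilon> / 2"
    "\<And>x. nrm (a - x) < \<delta>2 \<Longrightarrow> nrm (h a - h x) < \<epsilon> / 2"
    by blast
  have "nrm ((f a + h a) - (f x + h x)) < \<epsilon>" if "nrm (a - x) < min \<delta>1 \<delta>2" for x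
    using nrm_add_diff[of "f a" "h a" "f x" "h x"] \<delta>(3,4)[of x] that by simp
  then show "\<exists>\<delta>>0. \<forall>x. nrm (a - x) < \<delta> \<longrightarrow> nrm (f a + h a - (f x + h x)) < \<epsilon>"
    using \<delta>(1,2) by (intro exI[of _ "min \<delta>1 \<delta>2"]) simp
qed

end

subsection \<open>Perturbations of a hyperbolic automorphism\<close>

text \<open>By continuity at exponent 0, where the value is \<open>c\<close>. This supplies the
  Hoelder exponent: precomposition with an \<open>M\<close>-Lipschitz map costs a factor
  \<open>M powr \<alpha>\<close>, which must not use up the contraction.\<close>

lemma exists_powr_exponent:
  fixes c M :: real
  assumes "c < 1" "0 < M"
  shows "\<exists>\<alpha>. 0 < \<alpha> \<and> \<alpha> \<le> 1 \<and> c * M powr \<alpha> < 1"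
proof -
  have "((\<lambda>\<alpha>. c * M powr \<alpha>) \<longlongrightarrow> c * M powr 0) (at_right 0)"
    using assms by (intro tendsto_intros) auto
  then have "\<forall>\<^sub>F \<alpha> in at_right 0. c * M powr \<alpha> < 1"
    using assms by (intro order_tendstoD) auto
  moreover have "\<forall>\<^sub>F \<alpha>::real in at_right 0. \<alpha> < 1"
    by (intro eventually_at_right_real[THEN eventually_mono, of 0 1]) auto
  moreover have "\<forall>\<^sub>F \<alpha>::real in at_right 0. 0 < \<alpha>"
    by (rule eventually_at_right_less)
  ultimately have "\<forall>\<^sub>F \<alpha>::real in at_right 0. 0 < \<alpha> \<and> \<alpha> \<le> 1 \<and> c * M powr \<alpha> < 1"
    by eventually_elim auto
  then show ?thesis
    by (rule eventually_happens'[rotated]) auto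
qed

text \<open>\<open>S\<close> is the projection onto the stable subspace along the unstable one, and \<open>L\<close> a Lipschitz
  constant for the admissible perturbations of \<open>A\<close>.\<close>

locale hyperbolic_splitting = group_norm nrm
  for nrm :: "'e::ab_group_add \<Rightarrow> real" +
  fixes A B S :: "'e \<Rightarrow> 'e" and a b KA KB L :: real
  assumes complete: mcomplete
    and A_add: "A (x + y) = A x + A y"
    and S_add: "S (x + y) = S x + S y"
    and BA [simp]: "B (A x) = x" and AB [simp]: "A (B x) = x"
    and SS [simp]: "S (S x) = S x"
    and S_A: "S (A x) = A (S x)"
    and nrm_split: "nrm x = max (nrm (S x)) (nrm (x - S x))"
    and A_stable: "nrm (A (S x)) \<le> a * nrm (S x)"
    and B_unstable: "nrm (B (x - S x)) \<le> b * nrm (x - S x)"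
    and A_bound: "nrm (A x) \<le> KA * nrm x"
    and B_bound: "nrm (B x) \<le> KB * nrm x"
    and const_nonneg: "0 \<le> a" "0 \<le> b" "0 \<le> KA" "0 \<le> KB" "0 \<le> L"
    and L_bounds: "KB * L < 1" "a + L < 1" "b * (1 + L) < 1"
begin

lemma B_add: "B (x + y) = B x + B y"
  by (metis A_add AB BA)

sublocale A: Modules.additive A by standard (rule A_add)
sublocale B: Modules.additive B by standard (rule B_add)
sublocale S: Modules.additive S by standard (rule S_add)

lemma S_B: "S (B x) = B (S x)"
  by (metis AB BA S_A)

text \<open>Lets the inhomogeneous terms on the unstable side, which carry a factor
  \<open>b\<close>, share the bound of those on the stable side.\<close>

lemma b_le_1: "b \<le> 1"
proof -
  have "b * 1 \<le> b * (1 + L)"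
    using const_nonneg by (intro mult_left_mono) auto
  then show ?thesis
    using L_bounds by simp
qed

lemma nrm_S_le: "nrm (S x) \<le> nrm x" and nrm_U_le: "nrm (x - S x) \<le> nrm x"
  using nrm_split[of x] by auto

text \<open>The constant \<open>L\<close> is fixed by the locale, so that \<open>g\<close> and 0 are
  perturbations for the same data and can be paired in any order.\<close>

definition perturbation :: "('e \<Rightarrow> 'e) \<Rightarrow> bool"
  where "perturbation g \<longleftrightarrow> (\<forall>x y. nrm (g x - g y) \<le> L * nrm (x - y)) \<and> (\<exists>c. \<forall>x. nrm (g x) \<le> c)"

lemma perturbation_0 [simp]: "perturbation (\<lambda>x. 0)"
  using const_nonneg by (auto simp: perturbation_def)

lemma perturbation_lipschitz: "perturbation g \<Longrightarrow> nrm (g x - g y) \<le> L * nrm (x - y)"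
  by (simp add: perturbation_def)

lemma perturbed_lipschitz:
  assumes "perturbation g"
  shows "nrm ((A x + g x) - (A y + g y)) \<le> (KA + L) * nrm (x - y)"
  using nrm_add_diff[of "A x" "g x" "A y" "g y"] A_bound[of "x - y"]
    perturbation_lipschitz[OF assms, of x y] by (simp add: A.diff algebra_simps)

text \<open>\<open>A\<close> expands distances by at least \<open>1 / KB\<close>, and
  \<open>KB * L < 1\<close> absorbs the change due to \<open>g\<close>. This yields injectivity of
  \<open>A + g\<close> and the Lipschitz constant of its inverse.\<close>

lemma perturbed_expansive:
  assumes "perturbation g"
  shows "nrm (x - y) \<le> KB / (1 - KB * L) * nrm ((A x + g x) - (A y + g y))"
proof -
  have "nrm (x - y) \<le> KB * nrm (A x - A y)"
    using B_bound[of "A (x - y)"] by (simp add: A.diff[symmetric])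
  also have "\<dots> \<le> KB * (nrm ((A x + g x) - (A y + g y)) + nrm (g x - g y))"
    using nrm_diff_diff[of "A x + g x" "g x" "A y + g y" "g y"] const_nonneg
    by (intro mult_left_mono) simp_all
  also have "\<dots> \<le> KB * (nrm ((A x + g x) - (A y + g y)) + L * nrm (x - y))"
    using perturbation_lipschitz[OF assms] const_nonneg by (intro mult_left_mono add_left_mono)
  finally show ?thesis
    using L_bounds by (simp add: field_simps)
qed

text \<open>A solution is a fixed point of \<open>x \<mapsto> B (y - g x)\<close>, a contraction
  with factor \<open>KB * L\<close>.\<close>

lemma perturbed_surj:
  assumes "perturbation g"
  shows "\<exists>x. A x + g x = y"
proof -
  have "\<exists>x\<in>UNIV. (\<lambda>x _. B (y - g (x ()))) x = x"
  proof (rule uniform_contraction_fixpoint[of "KB * L"])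
    fix u v :: "unit \<Rightarrow> 'e" and D x
    assume D: "\<And>x. nrm (u x - v x) \<le> D"
    have "nrm (B (y - g (u ())) - B (y - g (v ()))) \<le> KB * nrm (g (u ()) - g (v ()))"
      using B_bound[of "g (v ()) - g (u ())"] by (simp add: B.diff[symmetric] nrm_minus_commute)
    also have "\<dots> \<le> KB * (L * D)"
      using perturbation_lipschitz[OF assms, of "u ()" "v ()"] D const_nonneg mult_left_mono[OF D, of L]
      by (intro mult_left_mono) (auto intro: order_trans)
    finally show "nrm (B (y - g (u ())) - B (y - g (v ()))) \<le> KB * L * D"
      by (simp add: mult.assoc)
  next
    show "nrm (B (y - g 0) - 0) \<le> nrm (B (y - g 0))" by simp
  qed (use const_nonneg L_bounds complete in auto)
  then obtain x :: "unit \<Rightarrow> 'e" where "B (y - g (x ())) = x ()"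
    by (metis (full_types))
  then have "A (x ()) + g (x ()) = y"
    by (metis AB diff_add_cancel)
  then show ?thesis ..
qed

lemma perturbed_inverse:
  assumes "perturbation g"
  obtains G where "\<And>x. G (A x + g x) = x" "\<And>y. A (G y) + g (G y) = y"
    "\<And>x y. nrm (G x - G y) \<le> KB / (1 - KB * L) * nrm (x - y)"
proof -
  obtain G where G: "\<And>y. A (G y) + g (G y) = y"
    using perturbed_surj[OF assms] by metis
  have GF: "G (A x + g x) = x" for x
    using perturbed_expansive[OF assms, of "G (A x + g x)" x] G by (metis nrm_0 diff_self mult_zero_right
        nrm_eq_0_iff nrm_nonneg antisym eq_iff_diff_eq_0)
  show ?thesis
    using that[of G] GF G perturbed_expansive[OF assms] by (metis)
qed

text \<open>The conjugacy equation, rewritten as a fixed point problem: the stable component is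
  transported forwards by \<open>A\<close>, the unstable one backwards by \<open>B\<close>.\<close>

definition hyp_op :: "'e \<Rightarrow> 'e \<Rightarrow> 'e \<Rightarrow> 'e \<Rightarrow> 'e"
  where "hyp_op p q r s = (A (S p) + S q) + B ((r - s) - S (r - s))"

lemma S_hyp_op: "S (hyp_op p q r s) = A (S p) + S q"
  by (simp add: hyp_op_def S.add S_A S_B S.diff B.zero)

lemma hyp_op_diff:
  "hyp_op p q r s - hyp_op p' q' r' s' = hyp_op (p - p') (q - q') (r - r') (s - s')"
  by (simp add: hyp_op_def A.add A.diff S.add S.diff B.add B.diff algebra_simps)

text \<open>The norm is the maximum over the two components: the stable one is contracted by
  \<open>A\<close>, the unstable one by \<open>B\<close>.\<close>

lemma nrm_hyp_op:
  "nrm (hyp_op p q r s) \<le> max (a * nrm p + nrm q) (b * (nrm r + nrm s))"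
proof -
  have "nrm (A (S p) + S q) \<le> a * nrm p + nrm q"
    using nrm_triangle[of "A (S p)" "S q"] A_stable[of p] nrm_S_le[of p] nrm_S_le[of q]
      mult_left_mono[OF nrm_S_le[of p] const_nonneg(1)] by linarith
  moreover have "nrm (hyp_op p q r s - S (hyp_op p q r s)) \<le> b * (nrm r + nrm s)"
  proof -
    have "nrm (B ((r - s) - S (r - s))) \<le> b * nrm ((r - s) - S (r - s))"
      by (rule B_unstable)
    also have "\<dots> \<le> b * (nrm r + nrm s)"
      using nrm_U_le[of "r - s"] nrm_triangle_diff[of r s] const_nonneg by (intro mult_left_mono) linarith+
    finally show ?thesis
      unfolding S_hyp_op by (simp add: hyp_op_def)
  qed
  ultimately show ?thesis
    using nrm_split[of "hyp_op p q r s"] unfolding S_hyp_op by linarith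
qed

end

section \<open>The fixed point operator of a pair of perturbations\<close>

locale perturbation_pair = hyperbolic_splitting +
  fixes g1 g2 G
  assumes g1: "perturbation g1" and g2: "perturbation g2"
    and GF [simp]: "G (A x + g2 x) = x" and FG [simp]: "A (G x) + g2 (G x) = x"
    and G_lipschitz: "nrm (G x - G y) \<le> KB / (1 - KB * L) * nrm (x - y)"
begin

definition F where "F x = A x + g2 x"
text \<open>The inhomogeneous term: cancelling \<open>A x\<close> turns the conjugacy equation into
  \<open>v (F x) = A (v x) + D v x\<close>.\<close>

definition D where "D v x = g1 (x + v x) - g2 x"
text \<open>The stable component of the equation is solved for \<open>v x\<close> by evaluating at
  \<open>G x\<close>, the unstable one by applying \<open>B\<close> to
  \<open>v (F x) - D v x\<close>.\<close>

definition \<Phi> where "\<Phi> v x = hyp_op (v (G x)) (D v (G x)) (v (F x)) (D v x)"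
text \<open>The larger of the contraction factors on the stable and on the unstable
  component.\<close>

definition \<theta> where "\<theta> = max (a + L) (b * (1 + L))"

lemma \<theta>: "0 \<le> \<theta>" "\<theta> < 1"
  using L_bounds const_nonneg by (auto simp: \<theta>_def le_max_iff_disj)

lemma fixpoint_iff: "\<Phi> v = v \<longleftrightarrow> (\<forall>x. A (x + v x) + g1 (x + v x) = F x + v (F x))"
proof -
  have "\<Phi> v = v \<longleftrightarrow> (\<forall>x. v (F x) = A (v x) + D v x)"
  proof safe
    fix x assume "\<Phi> v = v"
    then have v: "v y = hyp_op (v (G y)) (D v (G y)) (v (F y)) (D v y)" for y
      by (metis \<Phi>_def)
    \<comment> \<open>The fixed point equation is used at \<open>F x\<close>, where
      \<open>G (F x) = x\<close>.\<close>
    have S1: "S (v (F x)) = A (S (v x)) + S (D v x)"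
      by (subst v) (simp add: S_hyp_op F_def)
    have "v x - S (v x) = B ((v (F x) - D v x) - S (v (F x) - D v x))"
      using S_hyp_op v[of x] by (metis hyp_op_def add_diff_cancel_left')
    then have "A (v x) - A (S (v x)) = (v (F x) - D v x) - S (v (F x) - D v x)"
      by (metis A.diff AB)
    then show "v (F x) = A (v x) + D v x"
      using S1 by (simp add: S.diff algebra_simps)
  next
    assume eq: "\<forall>x. v (F x) = A (v x) + D v x"
    show "\<Phi> v = v"
    proof
      fix x
      have "v x = A (v (G x)) + D v (G x)"
        using eq[rule_format, of "G x"] by (simp add: F_def)
      then have "A (S (v (G x))) + S (D v (G x)) = S (v x)"
        by (simp add: S.add S_A)
      then show "\<Phi> v x = v x"
        by (simp add: \<Phi>_def hyp_op_def eq S_A B.diff S_B)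
    qed
  qed
  also have "\<dots> \<longleftrightarrow> (\<forall>x. A (x + v x) + g1 (x + v x) = F x + v (F x))"
    by (auto simp: D_def F_def A.add algebra_simps)
  finally show ?thesis .
qed

text \<open>One estimate for two purposes: \<open>x = y\<close> with \<open>Q = 0\<close> gives the
  contraction in the supremum norm, and \<open>u = v\<close> controls the Hoelder modulus.
  \<open>P\<close> bounds differences of values and \<open>Q\<close> displacements of base points;
  the factor 2 appears because both \<open>g1\<close> and \<open>g2\<close> feel the
  displacement.\<close>

lemma \<Phi>_diff:
  assumes "nrm (u (G x) - v (G y)) \<le> P" "nrm (u (F x) - v (F y)) \<le> P" "nrm (u x - v y) \<le> P"
    and "nrm (G x - G y) \<le> Q" "nrm (x - y) \<le> Q"
  shows "nrm (\<Phi> u x - \<Phi> v y) \<le> \<theta> * P + 2 * L * Q"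
proof -
  have D: "nrm (D u z - D v z') \<le> L * (P + 2 * Q)" if "nrm (u z - v z') \<le> P" "nrm (z - z') \<le> Q" for z z'
  proof -
    have "nrm (D u z - D v z') \<le> L * nrm ((z + u z) - (z' + v z')) + L * nrm (z - z')"
      unfolding D_def using nrm_diff_diff[of "g1 (z + u z)" "g2 z" "g1 (z' + v z')" "g2 z'"]
        perturbation_lipschitz[OF g1, of "z + u z" "z' + v z'"] perturbation_lipschitz[OF g2, of z z']
      by linarith
    also have "\<dots> = L * (nrm ((z + u z) - (z' + v z')) + nrm (z - z'))"
      by (simp add: algebra_simps)
    also have "\<dots> \<le> L * (P + 2 * Q)"
      using nrm_add_diff[of z "u z" z' "v z'"] that const_nonneg by (intro mult_left_mono) simp_all
    finally show ?thesis .
  qed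
  have PQ: "0 \<le> P" "0 \<le> Q"
    using assms(1,5) nrm_nonneg order_trans by blast+
  have "a * nrm (u (G x) - v (G y)) + nrm (D u (G x) - D v (G y)) \<le> a * P + L * (P + 2 * Q)"
    using assms const_nonneg by (intro add_mono mult_left_mono D) auto
  also have "\<dots> = (a + L) * P + 2 * L * Q"
    by (simp add: algebra_simps)
  also have "\<dots> \<le> \<theta> * P + 2 * L * Q"
    using PQ const_nonneg by (intro add_mono mult_right_mono) (auto simp: \<theta>_def)
  finally have 1: "a * nrm (u (G x) - v (G y)) + nrm (D u (G x) - D v (G y)) \<le> \<theta> * P + 2 * L * Q" .
  have "b * (nrm (u (F x) - v (F y)) + nrm (D u x - D v y)) \<le> b * (P + L * (P + 2 * Q))"
    using assms const_nonneg by (intro add_mono mult_left_mono D) auto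
  also have "\<dots> = (b * (1 + L)) * P + b * (2 * L * Q)"
    by (simp add: algebra_simps)
  also have "\<dots> \<le> \<theta> * P + 1 * (2 * L * Q)"
    using PQ b_le_1 const_nonneg by (intro add_mono mult_right_mono) (auto simp: \<theta>_def)
  finally have 2: "b * (nrm (u (F x) - v (F y)) + nrm (D u x - D v y)) \<le> \<theta> * P + 2 * L * Q"
    by simp
  show ?thesis
    unfolding \<Phi>_def hyp_op_diff using nrm_hyp_op 1 2 by (meson max.bounded_iff order_trans)
qed

lemma \<Phi>_contraction:
  assumes "\<And>x. nrm (u x - v x) \<le> P"
  shows "nrm (\<Phi> u x - \<Phi> v x) \<le> \<theta> * P"
  using \<Phi>_diff[of u x v x P 0] assms by simp

text \<open>Boundedness gives the finite initial distance \<open>c + c'\<close>, which each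
  application of \<open>\<Phi>\<close> multiplies by \<open>\<theta>\<close>.\<close>

lemma fixpoint_unique:
  assumes "\<Phi> u = u" "\<Phi> v = v" and c: "\<And>x. nrm (u x) \<le> c" "\<And>x. nrm (v x) \<le> c'"
  shows "u = v"
proof
  fix x
  have "nrm (u x - v x) \<le> (c + c') * \<theta> ^ k" for k x
  proof (induction k arbitrary: x)
    case 0
    then show ?case
      using nrm_triangle_diff[of "u x" "v x"] c(1)[of x] c(2)[of x] by simp
  next
    case (Suc k)
    then show ?case
      using \<Phi>_contraction[of u v "(c + c') * \<theta> ^ k" x] assms(1,2) by (simp add: mult_ac)
  qed
  moreover have "(\<lambda>k. (c + c') * \<theta> ^ k) \<longlonglongrightarrow> 0"
    using \<theta> by (intro tendsto_mult_right_zero LIMSEQ_power_zero) auto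
  ultimately have "nrm (u x - v x) \<le> 0"
    by (meson LIMSEQ_le_const)
  then show "u x = v x"
    by (metis antisym nrm_eq_0_iff nrm_nonneg eq_iff_diff_eq_0)
qed

lemma F_lipschitz: "nrm (F x - F y) \<le> (KA + L) * nrm (x - y)"
  unfolding F_def using perturbed_lipschitz[OF g2] .

text \<open>The iteration runs in the set \<open>X\<close> of maps bounded by \<open>R\<close> and
  Hoelder with constant \<open>C\<close>. Both bounds survive pointwise limits, so the fixed point
  inherits them.\<close>

lemma fixpoint_exists: "\<exists>v. \<Phi> v = v \<and> (\<exists>c. \<forall>x. nrm (v x) \<le> c) \<and> holder nrm v"
proof -
  \<comment> \<open>A common Lipschitz constant for \<open>F\<close>, \<open>G\<close> and the
    identity, the three maps through which \<open>\<Phi>\<close> evaluates \<open>v\<close>.\<close>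
  define M where "M = Max {1, KA + L, KB / (1 - KB * L)}"
  have M: "1 \<le> M" "KA + L \<le> M" "KB / (1 - KB * L) \<le> M"
    by (auto simp: M_def)
  have FM: "nrm (F x - F y) \<le> M * nrm (x - y)" for x y
    using F_lipschitz[of x y] mult_right_mono[OF M(2) nrm_nonneg[of "x - y"]] by simp
  have GM: "nrm (G x - G y) \<le> M * nrm (x - y)" for x y
    using G_lipschitz[of x y] mult_right_mono[OF M(3) nrm_nonneg[of "x - y"]] by linarith
  obtain \<alpha> where \<alpha>: "0 < \<alpha>" "\<alpha> \<le> 1" "\<theta> * M powr \<alpha> < 1"
    using exists_powr_exponent[of \<theta> M] \<theta> M by auto
  obtain c1 c2 where c12: "\<And>x. nrm (g1 x) \<le> c1" "\<And>x. nrm (g2 x) \<le> c2"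
    using g1 g2 unfolding perturbation_def by blast
  define c where "c = c1 + c2"
  have D0: "nrm (D (\<lambda>_. 0) x) \<le> c" for x
    using nrm_triangle_diff[of "g1 x" "g2 x"] c12(1)[of x] c12(2)[of x] by (simp add: D_def c_def)
  have c: "0 \<le> c"
    using D0 nrm_nonneg order_trans by blast
  have \<Phi>0: "nrm (\<Phi> (\<lambda>_. 0) x) \<le> c" for x
  proof -
    have "b * nrm (D (\<lambda>_. 0) x) \<le> 1 * c"
      using b_le_1 c D0 by (intro mult_mono) auto
    then show ?thesis
      unfolding \<Phi>_def
      using nrm_hyp_op[of 0 "D (\<lambda>_. 0) (G x)" 0 "D (\<lambda>_. 0) x"] D0[of "G x"]
      by (simp del: nrm_eq_0_iff)
  qed
  \<comment> \<open>Chosen so that \<open>\<theta> * R + c = R\<close>, which keeps the ball of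
    radius \<open>R\<close> invariant since \<open>\<Phi> 0\<close> is bounded by
    \<open>c\<close>.\<close>
  define R where "R = c / (1 - \<theta>)"
  have R: "0 \<le> R" "\<theta> * R + c = R"
    using \<theta> c by (auto simp: R_def field_simps)
  \<comment> \<open>The entry \<open>2 * R\<close> settles points at distance at least 1, where
    boundedness suffices. The other entry makes
    \<open>\<theta> * C * M powr \<alpha> + 2 * L * M \<le> C\<close>, the invariance condition at
    distances below 1.\<close>
  define C where "C = max (2 * R) (2 * L * M / (1 - \<theta> * M powr \<alpha>))"
  have C: "2 * R \<le> C" "2 * L * M / (1 - \<theta> * M powr \<alpha>) \<le> C" "0 \<le> C"
    using R(1) by (auto simp: C_def)
  have C': "\<theta> * (C * M powr \<alpha>) + 2 * L * M \<le> C"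
    using C(2) \<alpha>(3) by (simp add: field_simps)
  define X where "X = {v. (\<forall>x. nrm (v x) \<le> R) \<and> (\<forall>x y. nrm (v x - v y) \<le> C * nrm (x - y) powr \<alpha>)}"
  have "\<exists>v\<in>X. \<Phi> v = v"
  proof (rule uniform_contraction_fixpoint[OF complete \<theta>])
    show "(\<lambda>_. 0) \<in> X"
      using R C by (simp add: X_def)
    show "\<Phi> v \<in> X" if v: "v \<in> X" for v
    proof -
      have vR: "nrm (v x) \<le> R" and vC: "nrm (v x - v y) \<le> C * nrm (x - y) powr \<alpha>" for x y
        using v by (auto simp: X_def)
      have \<Phi>R: "nrm (\<Phi> v x) \<le> R" for x
        using nrm_triangle_via[of "\<Phi> v x" 0 "\<Phi> (\<lambda>_. 0) x"] \<Phi>_contraction[of v "\<lambda>_. 0" R x] vR \<Phi>0[of x] R(2)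
        by simp
      moreover have "nrm (\<Phi> v x - \<Phi> v y) \<le> C * nrm (x - y) powr \<alpha>" for x y
      proof (cases "nrm (x - y) \<ge> 1")
        case True
        have "nrm (\<Phi> v x - \<Phi> v y) \<le> C * 1"
          using nrm_triangle_diff[of "\<Phi> v x" "\<Phi> v y"] \<Phi>R[of x] \<Phi>R[of y] C by simp
        also have "\<dots> \<le> C * nrm (x - y) powr \<alpha>"
          using True \<alpha> C by (intro mult_left_mono ge_one_powr_ge_zero) auto
        finally show ?thesis .
      next
        case False
        define d where "d = nrm (x - y)"
        have d: "0 \<le> d" "d \<le> 1"
          using False by (auto simp: d_def)
        \<comment> \<open>Here \<open>\<alpha> \<le> 1\<close> enters: at small distances the
          Lipschitz terms are dominated by Hoelder terms.\<close>
        have d_powr: "d \<le> d powr \<alpha>"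
          using d \<alpha> powr_mono'[of \<alpha> 1 d] by (cases "d = 0") auto
        have hold: "nrm (v z - v z') \<le> C * (M * d) powr \<alpha>" if "nrm (z - z') \<le> M * d" for z z'
          using vC[of z z'] that \<alpha> C mult_left_mono[OF powr_mono2[OF _ _ that, of \<alpha>] C(3)] by simp
        have xy: "nrm (x - y) \<le> M * d"
          using M d mult_right_mono[of 1 M d] by (simp add: d_def)
        have "nrm (\<Phi> v x - \<Phi> v y) \<le> \<theta> * (C * (M * d) powr \<alpha>) + 2 * L * (M * d)"
          using FM[of x y] GM[of x y] xy by (intro \<Phi>_diff hold) (auto simp: d_def)
        also have "\<dots> \<le> \<theta> * (C * M powr \<alpha>) * d powr \<alpha> + 2 * L * M * d powr \<alpha>"
          using d_powr const_nonneg M d by (intro add_mono) (auto simp: powr_mult mult_ac intro!: mult_left_mono)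
        also have "\<dots> \<le> C * d powr \<alpha>"
          using mult_right_mono[OF C', of "d powr \<alpha>"] by (simp add: algebra_simps)
        finally show ?thesis
          by (simp add: d_def)
      qed
      ultimately show ?thesis
        by (simp add: X_def)
    qed
    show "nrm (\<Phi> u x - \<Phi> v x) \<le> \<theta> * P" if "\<And>x. nrm (u x - v x) \<le> P" for u v P x
      using \<Phi>_contraction that by blast
    show "nrm (\<Phi> (\<lambda>_. 0) x - 0) \<le> c" for x
      using \<Phi>0 by simp
    show "v \<in> X" if u: "\<And>k. u k \<in> X" and lim: "\<And>x. (\<lambda>k. nrm (u k x - v x)) \<longlonglongrightarrow> 0" for u v
    proof -
      have "nrm (v x) \<le> R" for x
        using nrm_limit_le[OF lim, of 0 x 0 R] u by (simp add: X_def)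
      moreover have "nrm (v x - v y) \<le> C * nrm (x - y) powr \<alpha>" for x y
      proof -
        have "(\<lambda>k. nrm (u k x - v x) + nrm (u k y - v y)) \<longlonglongrightarrow> 0"
          using tendsto_add[OF lim lim] by simp
        then have "(\<lambda>k. nrm ((u k x - u k y) - (v x - v y))) \<longlonglongrightarrow> 0"
          by (rule Lim_null_comparison[rotated]) (simp add: nrm_diff_diff)
        then show ?thesis
          using nrm_limit_le[of "\<lambda>k. u k x - u k y" "v x - v y" 0 0] u by (simp add: X_def)
      qed
      ultimately show ?thesis
        by (simp add: X_def)
    qed
  qed
  then obtain v where "v \<in> X" "\<Phi> v = v" by blast
  moreover from this have "holder nrm v"
    unfolding holder_def X_def using \<alpha> C(3) by blast
  ultimately show ?thesis
    unfolding X_def by blast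
qed

end

section \<open>Existence and uniqueness of bounded solutions\<close>

context hyperbolic_splitting
begin

lemma conjugacy_exists:
  assumes "perturbation g1" "perturbation g2"
  shows "\<exists>v. (\<forall>x. A (x + v x) + g1 (x + v x) = (A x + g2 x) + v (A x + g2 x)) \<and>
    (\<exists>c. \<forall>x. nrm (v x) \<le> c) \<and> holder nrm v"
proof -
  obtain G where "\<And>x. G (A x + g2 x) = x" "\<And>y. A (G y) + g2 (G y) = y"
    "\<And>x y. nrm (G x - G y) \<le> KB / (1 - KB * L) * nrm (x - y)"
    using perturbed_inverse[OF assms(2)] by blast
  then interpret perturbation_pair nrm A B S a b KA KB L g1 g2 G
    using assms by unfold_locales
  show ?thesis
    using fixpoint_exists unfolding fixpoint_iff F_def by blast
qed

lemma conjugacy_unique: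
  assumes "perturbation g1" "perturbation g2"
    and "\<And>x. A (x + u x) + g1 (x + u x) = (A x + g2 x) + u (A x + g2 x)" "\<And>x. nrm (u x) \<le> c"
    and "\<And>x. A (x + v x) + g1 (x + v x) = (A x + g2 x) + v (A x + g2 x)" "\<And>x. nrm (v x) \<le> c'"
  shows "u = v"
proof -
  obtain G where "\<And>x. G (A x + g2 x) = x" "\<And>y. A (G y) + g2 (G y) = y"
    "\<And>x y. nrm (G x - G y) \<le> KB / (1 - KB * L) * nrm (x - y)"
    using perturbed_inverse[OF assms(2)] by blast
  then interpret perturbation_pair nrm A B S a b KA KB L g1 g2 G
    using assms by unfold_locales
  show ?thesis
    using fixpoint_unique[of u v c c'] assms(3-) unfolding fixpoint_iff F_def by blast
qed

end

section \<open>The two solutions as mutually inverse homeomorphisms\<close>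

context hyperbolic_splitting
begin

theorem topological_conjugacy:
  fixes g
  defines "F \<equiv> \<lambda>x. A x + g x"
  assumes g: "perturbation g"
  shows "(\<exists>!v. bounded_semiconjugacy mtopology nrm F A v) \<and>
    (\<forall>v. bounded_semiconjugacy mtopology nrm F A v \<longrightarrow>
      homeomorphic_map mtopology mtopology (\<lambda>x. x + v x) \<and> holder nrm v \<and>
      (let w = (\<lambda>x. inv (\<lambda>y. y + v y) x - x) in
        holder nrm w \<and> bounded_semiconjugacy mtopology nrm A F w \<and>
        (\<forall>w'. bounded_semiconjugacy mtopology nrm A F w' \<longrightarrow> w' = w)) \<and>
      (g 0 = 0 \<longrightarrow> v 0 = 0))"
proof -
  have v_iff: "bounded_semiconjugacy mtopology nrm F A v \<longleftrightarrow>
      (\<exists>c. \<forall>x. nrm (v x) \<le> c) \<and> continuous_map mtopology mtopology v \<and>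
      (\<forall>x. F (x + v x) = A x + v (A x))" for v
    by (auto simp: bounded_semiconjugacy_def bounded_map_def bdd_above_def fun_eq_iff)
  have w_iff: "bounded_semiconjugacy mtopology nrm A F w \<longleftrightarrow>
      (\<exists>c. \<forall>x. nrm (w x) \<le> c) \<and> continuous_map mtopology mtopology w \<and>
      (\<forall>x. A (x + w x) = F x + w (F x))" for w
    by (auto simp: bounded_semiconjugacy_def bounded_map_def bdd_above_def fun_eq_iff)
  obtain v c where v: "\<And>x. F (x + v x) = A x + v (A x)" "\<And>x. nrm (v x) \<le> c" "holder nrm v"
    using conjugacy_exists[OF g perturbation_0] unfolding F_def by auto
  obtain w d where w: "\<And>x. A (x + w x) = F x + w (F x)" "\<And>x. nrm (w x) \<le> d" "holder nrm w"
    using conjugacy_exists[OF perturbation_0 g] unfolding F_def by auto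
  have v_unique: "v' = v" if "bounded_semiconjugacy mtopology nrm F A v'" for v'
    using that[unfolded v_iff] v conjugacy_unique[OF g perturbation_0, of v' _ v c]
    by (auto simp: F_def)
  have w_unique: "w' = w" if "bounded_semiconjugacy mtopology nrm A F w'" for w'
    using that[unfolded w_iff] w conjugacy_unique[OF perturbation_0 g, of w' _ w d]
    by (auto simp: F_def)
  have cont: "continuous_map mtopology mtopology v" "continuous_map mtopology mtopology w"
    using v w continuous_map_if_holder by auto
  \<comment> \<open>The identity is the only map at bounded distance from itself that commutes with
    \<open>A\<close>; \<open>F_rigid\<close> says the same for \<open>F\<close>.\<close>
  have A_rigid: "u = (\<lambda>_. 0)" if "\<And>x. A (x + u x) = A x + u (A x)" "\<And>x. nrm (u x) \<le> k" for u k
    by (rule conjugacy_unique[OF perturbation_0 perturbation_0, of _ k _ 0]) (use that in auto)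
  have F_rigid: "u = (\<lambda>_. 0)" if "\<And>x. F (x + u x) = F x + u (F x)" "\<And>x. nrm (u x) \<le> k" for u k
    by (rule conjugacy_unique[OF g g, of _ k _ 0]) (use that in \<open>auto simp: F_def\<close>)
  define h k where "h x = x + v x" and "k x = x + w x" for x
  have Fh: "F (h x) = h (A x)" and Ak: "A (k x) = k (F x)" for x
    using v w by (auto simp: h_def k_def)
  \<comment> \<open>\<open>k \<circ> h\<close> commutes with \<open>A\<close>, because
    \<open>h\<close> carries \<open>A\<close> to \<open>F\<close> and \<open>k\<close> carries
    \<open>F\<close> back to \<open>A\<close>; its displacement \<open>v x + w (h x)\<close> is
    bounded.\<close>
  have kh: "k (h x) = x" for x
  proof -
    have "(\<lambda>x. k (h x) - x) = (\<lambda>_. 0)"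
    proof (rule A_rigid)
      show "A (x + (k (h x) - x)) = A x + (k (h (A x)) - A x)" for x
        by (simp add: Fh Ak)
      show "nrm (k (h x) - x) \<le> c + d" for x
        using nrm_triangle[of "v x" "w (x + v x)"] v(2)[of x] w(2)[of "x + v x"]
        by (simp add: h_def k_def add.assoc)
    qed
    then show ?thesis by (metis eq_iff_diff_eq_0)
  qed
  have hk: "h (k x) = x" for x
  proof -
    have "(\<lambda>x. h (k x) - x) = (\<lambda>_. 0)"
    proof (rule F_rigid)
      show "F (x + (h (k x) - x)) = F x + (h (k (F x)) - F x)" for x
        by (simp add: Fh Ak)
      show "nrm (h (k x) - x) \<le> c + d" for x
        using nrm_triangle[of "w x" "v (x + w x)"] w(2)[of x] v(2)[of "x + w x"]
        by (simp add: h_def k_def add.assoc)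
    qed
    then show ?thesis by (metis eq_iff_diff_eq_0)
  qed
  have "inv h = k"
    using hk kh by (metis inv_unique_comp ext comp_apply id_apply)
  then have w_eq: "(\<lambda>x. inv (\<lambda>y. y + v y) x - x) = w"
    by (auto simp: h_def[abs_def] k_def)
  have "homeomorphic_maps mtopology mtopology h k"
    unfolding homeomorphic_maps_def h_def[abs_def] k_def[abs_def]
    using continuous_map_add[OF continuous_map_id[unfolded id_def]] cont hk kh
    by (auto simp: h_def k_def)
  then have homeo: "homeomorphic_map mtopology mtopology (\<lambda>x. x + v x)"
    unfolding h_def[abs_def] using homeomorphic_maps_map by blast
  \<comment> \<open>If \<open>F\<close> fixes 0, then \<open>A\<close> fixes \<open>w 0\<close>, so
    the constant map \<open>w 0\<close> solves the equation in \<open>A_rigid\<close> and vanishes.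
    Hence \<open>k 0 = 0\<close>, and \<open>h\<close> fixes 0 too.\<close>
  have v0: "v 0 = 0" if "g 0 = 0"
  proof -
    have "F 0 = 0" using that by (simp add: F_def A.zero)
    then have "A (w 0) = w 0"
      using w(1)[of 0] by simp
    then have "w 0 = 0"
      using fun_cong[OF A_rigid[of "\<lambda>_. w 0" "nrm (w 0)"]] by (simp add: A.add)
    then show ?thesis
      using hk[of 0] by (simp add: h_def k_def)
  qed
  have v_sol: "bounded_semiconjugacy mtopology nrm F A v"
    using v cont unfolding v_iff by blast
  have w_sol: "bounded_semiconjugacy mtopology nrm A F w"
    using w cont unfolding w_iff by blast
  show ?thesis
  proof (intro conjI allI impI)
    show "\<exists>!v. bounded_semiconjugacy mtopology nrm F A v"
      using v_sol v_unique by blast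
  next
    fix v' assume "bounded_semiconjugacy mtopology nrm F A v'"
    then have eq: "v' = v" by (rule v_unique)
    then show "homeomorphic_map mtopology mtopology (\<lambda>x. x + v' x)" "holder nrm v'"
      "let w = (\<lambda>x. inv (\<lambda>y. y + v' y) x - x) in
        holder nrm w \<and> bounded_semiconjugacy mtopology nrm A F w \<and>
        (\<forall>w'. bounded_semiconjugacy mtopology nrm A F w' \<longrightarrow> w' = w)"
      "g 0 = 0 \<Longrightarrow> v' 0 = 0"
      unfolding eq Let_def w_eq using homeo v(3) w(3) w_sol w_unique v0 by blast+
  qed
qed

end

subsection \<open>Operator norms, completeness and boundedness\<close>

context group_norm
begin

text \<open>The supremum runs over nonzero vectors; \<open>B 0 = 0\<close> covers the remaining
  one.\<close>

lemma opnorm_on_bound: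
  assumes "opnorm_on nrm F B = ennreal c" "0 \<le> c" "x \<in> F" "B 0 = 0"
  shows "nrm (B x) \<le> c * nrm x"
proof (cases "x = 0")
  case False
  then have pos: "0 < nrm x"
    using nrm_nonneg[of x] nrm_eq_0_iff[of x] by linarith
  have "ennreal (nrm (B x) / nrm x) \<le> opnorm_on nrm F B"
    unfolding opnorm_on_def using assms False by (intro SUP_upper) auto
  then show ?thesis
    using assms pos by (simp add: field_simps)
qed (use assms in simp)

text \<open>Every admissible constant dominates each difference quotient, hence so does the infimum:
  the smallest Lipschitz constant is attained.\<close>

lemma Lip_bound:
  assumes "Lip nrm f = ennreal L" "0 \<le> L"
  shows "nrm (f x - f y) \<le> L * nrm (x - y)"
proof (cases "x = y")
  case False
  then have pos: "0 < nrm (x - y)"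
    using nrm_nonneg[of "x - y"] nrm_eq_0_iff[of "x - y"] by (simp add: less_le)
  have "ennreal (nrm (f x - f y) / nrm (x - y)) \<le> Lip nrm f"
    unfolding Lip_def
  proof (rule INF_greatest)
    fix L' assume "L' \<in> {L. 0 \<le> L \<and> (\<forall>x y. nrm (f x - f y) \<le> L * nrm (x - y))}"
    then have "nrm (f x - f y) / nrm (x - y) \<le> L'"
      using pos by (simp add: field_simps)
    then show "ennreal (nrm (f x - f y) / nrm (x - y)) \<le> ennreal L'"
      by (rule ennreal_leI)
  qed
  then show ?thesis
    using assms pos by (simp add: field_simps)
qed simp

end

text \<open>Cauchy sequences only depend on the neighbourhoods of \<open>0\<close>, so two norms with the same
  topology are simultaneously complete.\<close>

lemma mcomplete_if_norm_topology_eq: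
  assumes n: "group_norm n" and n': "group_norm n'"
    and top_eq: "norm_topology n = norm_topology n'" and complete: "mcomplete_of (norm_metric n)"
  shows "mcomplete_of (norm_metric n')"
proof -
  interpret N: group_norm n by (rule n)
  interpret N': group_norm n' by (rule n')
  have tops: "N.mtopology = N'.mtopology"
    using top_eq by (simp add: N.mtopology_eq N'.mtopology_eq)
  have "\<exists>x. limitin N'.mtopology \<sigma> x sequentially" if \<sigma>: "N'.MCauchy \<sigma>" for \<sigma>
  proof -
    have "N.MCauchy \<sigma>"
      unfolding N.MCauchy_def
    proof safe
      fix \<epsilon> :: real assume "0 < \<epsilon>"
      then have "openin N'.mtopology (N.mball 0 \<epsilon>)" "0 \<in> N.mball 0 \<epsilon>"
        by (auto simp: tops[symmetric])
      then obtain \<delta> where \<delta>: "0 < \<delta>" "N'.mball 0 \<delta> \<subseteq> N.mball 0 \<epsilon>"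
        unfolding N'.openin_mtopology by blast
      \<comment> \<open>Translation invariance of the distance spreads the inclusion of balls at 0
        to all pairs of points.\<close>
      have small: "n (x - y) < \<epsilon>" if "n' (x - y) < \<delta>" for x y
        using that \<delta>(2) by (auto simp: subset_iff dest!: spec[of _ "x - y"])
      obtain M where "\<forall>i j. M \<le> i \<longrightarrow> M \<le> j \<longrightarrow> n' (\<sigma> i - \<sigma> j) < \<delta>"
        using \<sigma> \<delta>(1) unfolding N'.MCauchy_def by blast
      then show "\<exists>M. \<forall>i j. M \<le> i \<longrightarrow> M \<le> j \<longrightarrow> n (\<sigma> i - \<sigma> j) < \<epsilon>"
        using small by blast
    qed auto
    then show ?thesis
      using complete unfolding N.mcomplete_eq[symmetric] N.mcomplete_def tops by blast
  qed
  then show ?thesis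
    unfolding N'.mcomplete_eq[symmetric] N'.mcomplete_def by blast
qed

section \<open>Large scalars and boundedness of continuous linear maps\<close>

context valued_field
begin

lemma absv_1: "absv 1 = 1"
  using absv_mult[of 1 1] absv_eq_0_iff[of 1] by simp

lemma absv_inverse: "absv (inverse a) = inverse (absv a)"
  by (metis absv_1 absv_eq_0_iff absv_mult inverse_unique inverse_zero right_inverse)

lemma absv_power: "absv (a ^ n) = absv a ^ n"
  by (induction n) (simp_all add: absv_1 absv_mult)

lemma absv_power_int: "absv (a powi k) = absv a powi k"
  by (simp add: power_int_def absv_power absv_inverse)

text \<open>Otherwise, passing to inverses, all nonzero scalars have absolute value 1, and the
  topology is discrete.\<close>

lemma exists_absv_gt_1: "\<exists>a. 1 < absv a"
proof (rule ccontr)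
  assume "\<not> ?thesis"
  then have le_1: "absv a \<le> 1" for a
    by (simp add: not_less)
  interpret Metric_space UNIV "\<lambda>a b. absv (a - b)"
    by (rule Metric_space_absv)
  have one: "1 \<le> absv a" if "a \<noteq> 0" for a
    using le_1[of "inverse a"] that absv_nonneg[of a]
    by (simp add: absv_inverse absv_eq_0_iff inverse_le_1_iff)
  have "openin mtopology {x}" for x
  proof -
    have "mball x 1 = {x}"
      using one[of "x - y" for y] absv_eq_0_iff[of 0] by (force simp: mball_def not_less[symmetric])
    then show ?thesis
      by (metis openin_mball)
  qed
  then have "mtopology = discrete_topology UNIV"
    by (metis discrete_topology_unique topspace_mtopology)
  then show False
    using not_discrete by (simp add: norm_metric_def)
qed

end

context valued_normed_space
begin

lemma group_norm: "group_norm nrm"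
proof
  show "nrm (- x) = nrm x" for x
    using Metric_space.commute[OF Metric_space_nrm, of 0 x] by simp
qed (auto simp: nrm_nonneg nrm_eq_0_iff nrm_triangle)

text \<open>Absolute values need not fill the positive reals, so vectors cannot be normalised
  exactly. Powers of a fixed \<open>a\<close> with \<open>absv a > 1\<close> bring the norm of
  \<open>x\<close> between \<open>\<delta> / absv a\<close> and \<open>\<delta>\<close>, at the cost
  of a factor \<open>absv a\<close>.\<close>

lemma linear_continuous_bounded:
  assumes lin: "Vector_Spaces.linear smul smul A"
    and cont: "continuous_map (norm_topology nrm) (norm_topology nrm) A"
  shows "\<exists>K\<ge>0. \<forall>x. nrm (A x) \<le> K * nrm x"
proof -
  interpret A: Vector_Spaces.linear smul smul A by (rule lin)
  interpret group_norm nrm by (rule group_norm)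
  have "\<exists>\<delta>>0. \<forall>x. nrm (0 - x) < \<delta> \<longrightarrow> nrm (A 0 - A x) < 1"
    using cont zero_less_one unfolding mtopology_eq[symmetric] continuous_map_nrm_iff by blast
  then obtain \<delta> where \<delta>: "0 < \<delta>" "\<And>x. nrm x < \<delta> \<Longrightarrow> nrm (A x) < 1"
    by (auto simp: A.zero)
  obtain a where a: "1 < absv a"
    using exists_absv_gt_1 by blast
  have "nrm (A x) \<le> absv a / \<delta> * nrm x" for x
  proof (cases "x = 0")
    case False
    then have pos: "0 < nrm x"
      using nrm_nonneg[of x] nrm_eq_0_iff[of x] by linarith
    define t where "t = \<delta> / nrm x"
    have "0 < t"
      using pos \<delta> by (simp add: t_def)
    \<comment> \<open>The largest integer with \<open>absv a powi k < t\<close>; subtracting 1 from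
      the ceiling keeps the inequality strict, as the open \<open>\<delta>\<close>-ball
      requires.\<close>
    define k where "k = \<lceil>log (absv a) t\<rceil> - 1"
    define s where "s = absv a powi k"
    have s: "0 < s"
      using a by (simp add: s_def zero_less_power_int)
    have "of_int k < log (absv a) t" "log (absv a) t \<le> of_int k + 1"
      unfolding k_def by linarith+
    then have "absv a powr of_int k < t" "t \<le> absv a powr (of_int k + 1)"
      using a \<open>0 < t\<close> by (simp_all add: less_log_iff log_le_iff)
    then have st: "s < t" "t \<le> absv a * s"
      using a by (simp_all add: s_def powr_real_of_int' powr_add mult.commute)
    have "nrm (smul (a powi k) x) < \<delta>"
      using st pos by (simp add: nrm_scale absv_power_int s_def[symmetric] t_def field_simps)
    then have "nrm (A (smul (a powi k) x)) < 1"
      by (rule \<delta>(2))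
    then have "s * nrm (A x) < 1"
      by (simp add: A.scale nrm_scale absv_power_int s_def)
    then have "nrm (A x) \<le> 1 / s"
      using s by (simp add: field_simps)
    also have "1 / s \<le> absv a / t"
      using st s \<open>0 < t\<close> by (simp add: field_simps)
    finally show ?thesis
      by (simp add: t_def)
  qed (simp add: A.zero)
  then show ?thesis
    using a \<delta> by (intro exI[of _ "absv a / \<delta>"]) simp
qed

end

section \<open>Extracting real constants and the splitting from the hypotheses\<close>

lemma ennreal_cases_less_top:
  assumes "x < top"
  obtains r where "0 \<le> r" "x = ennreal r"
  using assms by (cases x) auto

theorem theoremA:
  fixes absv :: "'k::field \<Rightarrow> real"
    and smul :: "'k \<Rightarrow> 'e::ab_group_add \<Rightarrow> 'e"
    and nrm0 nrm :: "'e \<Rightarrow> real"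
    and T :: "'e topology"
    and A g :: "'e \<Rightarrow> 'e"
    and Es Eu :: "'e set"
  assumes banach: "valued_banach_space absv smul nrm0"
    and T: "T = norm_topology nrm0"
    and auto: "tvs_automorphism smul T A"
    and hyp: "hyperbolic absv smul T A"
    and adapted: "adapted_norm absv smul T A Es Eu nrm"
    and bounded: "bounded_map nrm g"
    and lipschitz: "Lipschitz_continuous_map (norm_metric nrm) (norm_metric nrm) g"
    and "Lip nrm g < inverse (opnorm_on nrm UNIV (inv A))"
    and "opnorm_on nrm Eu (inv A) * (1 + Lip nrm g) < 1"
    and "opnorm_on nrm Es A + Lip nrm g < 1"
  shows "(\<exists>!v. bounded_semiconjugacy T nrm (\<lambda>x. A x + g x) A v) \<and>
    (\<forall>v. bounded_semiconjugacy T nrm (\<lambda>x. A x + g x) A v \<longrightarrow>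
      homeomorphic_map T T (\<lambda>x. x + v x) \<and>
      holder nrm v \<and>
      (let w = (\<lambda>x. inv (\<lambda>y. y + v y) x - x) in
        holder nrm w \<and>
        bounded_semiconjugacy T nrm A (\<lambda>x. A x + g x) w \<and>
        (\<forall>w'. bounded_semiconjugacy T nrm A (\<lambda>x. A x + g x) w' \<longrightarrow> w' = w)) \<and>
      (g 0 = 0 \<longrightarrow> v 0 = 0))"
proof -
  interpret V: valued_normed_space absv smul nrm
    using adapted by (simp add: adapted_norm_def)
  interpret V0: valued_banach_space absv smul nrm0
    by (rule banach)
  interpret N: group_norm nrm
    by (rule V.group_norm)
  have subspaces: "V.subspace Es" "V.subspace Eu" and invariant: "A ` Es \<subseteq> Es" "A ` Eu \<subseteq> Eu"
    and direct: "Es \<inter> Eu = {0}" and span: "\<And>z. \<exists>x\<in>Es. \<exists>y\<in>Eu. z = x + y"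
    and T': "norm_topology nrm = T"
    and max: "\<And>x y. \<lbrakk>x \<in> Es; y \<in> Eu\<rbrakk> \<Longrightarrow> nrm (x + y) = max (nrm x) (nrm y)"
    and opnorm_u: "opnorm_on nrm Eu (inv A) < 1"
    using adapted by (auto simp: adapted_norm_def)
  have lin: "Vector_Spaces.linear smul smul A" and homeo: "homeomorphic_map T T A"
    using auto by (auto simp: tvs_automorphism_def)
  interpret A: Vector_Spaces.linear smul smul A
    by (rule lin)
  have T_eq: "T = N.mtopology"
    by (simp add: N.mtopology_eq T')
  have "bij A"
    using homeo homeomorphic_map_maps by (metis N.topspace_mtopology bij_betw_def homeomorphic_imp_injective_map homeomorphic_imp_surjective_map T_eq)
  then have BA: "inv A (A x) = x" and AB: "A (inv A x) = x" for x
    by (simp_all add: bij_is_inj bij_is_surj surj_f_inv_f)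
  have B0: "inv A 0 = 0"
    using BA[of 0] by (simp add: A.zero)

  obtain S where S: "\<And>z. S z \<in> Es" "\<And>z. z - S z \<in> Eu"
    using span by (metis add_diff_cancel_left')
  \<comment> \<open>\<open>S\<close> is merely a chosen component; its additivity, idempotence and
    commutation with \<open>A\<close> all follow from uniqueness of the decomposition.\<close>
  have S_unique: "S z = x" if "x \<in> Es" "z - x \<in> Eu" for x z
  proof -
    have "S z - x \<in> Es" "(z - x) - (z - S z) \<in> Eu"
      using that S subspaces V.subspace_diff by blast+
    then have "S z - x \<in> Es \<inter> Eu" by simp
    then show ?thesis using direct by simp
  qed
  have U_add: "(x + y) - (S x + S y) \<in> Eu" for x y
    using V.subspace_add[OF subspaces(2) S(2)[of x] S(2)[of y]] by (simp add: algebra_simps)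

  have "opnorm_on nrm Es A + Lip nrm g < top"
    using assms(10) less_trans ennreal_one_less_top by blast
  then have "opnorm_on nrm Es A < top" "Lip nrm g < top"
    by auto
  then obtain a L where a: "0 \<le> a" "opnorm_on nrm Es A = ennreal a"
    and L: "0 \<le> L" "Lip nrm g = ennreal L"
    by (metis ennreal_cases_less_top)
  obtain b where b: "0 \<le> b" "opnorm_on nrm Eu (inv A) = ennreal b"
    using opnorm_u ennreal_one_less_top less_trans ennreal_cases_less_top by metis
  \<comment> \<open>An infinite operator norm would have inverse 0, and no Lipschitz constant is
    below 0.\<close>
  have "opnorm_on nrm UNIV (inv A) < top"
    using assms(8) by (auto simp: less_top[symmetric])
  then obtain KB where KB: "0 \<le> KB" "opnorm_on nrm UNIV (inv A) = ennreal KB"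
    by (metis ennreal_cases_less_top)
  obtain KA where KA: "0 \<le> KA" "\<And>x. nrm (A x) \<le> KA * nrm x"
    using V.linear_continuous_bounded[OF lin] homeo T' homeomorphic_imp_continuous_map by metis
  have aL: "a + L < 1"
    using assms(10) a L by (simp add: ennreal_plus[symmetric] del: ennreal_plus)
  have bL: "b * (1 + L) < 1"
  proof -
    have "ennreal b * (1 + ennreal L) = ennreal (b * (1 + L))"
      using b L by (simp add: ennreal_mult)
    then show ?thesis
      using assms(9) b L by simp
  qed
  \<comment> \<open>For \<open>KB = 0\<close>, as on the zero space, the inverse is infinite and has
    no real counterpart; the product is then 0.\<close>
  have KBL: "KB * L < 1"
  proof (cases "KB = 0")
    case False
    then have "L < inverse KB"
      using assms(8) KB L by (simp add: inverse_ennreal ennreal_less_iff)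
    then show ?thesis
      using KB False by (simp add: field_simps)
  qed simp

  interpret hyperbolic_splitting nrm A "inv A" S a b KA KB L
  proof
    \<comment> \<open>Completeness is given for \<open>nrm0\<close> and passes to the adapted norm,
      which defines the same topology.\<close>
    show "N.mcomplete"
      unfolding N.mcomplete_eq using V0.group_norm V.group_norm T T' V0.complete
      by (intro mcomplete_if_norm_topology_eq[of nrm0 nrm]) auto
    show "S (x + y) = S x + S y" for x y
      using S U_add V.subspace_add[OF subspaces(1)] by (intro S_unique) auto
    show "S (S x) = S x" for x
      using S V.subspace_0[OF subspaces(2)] by (intro S_unique) auto
    show "S (A x) = A (S x)" for x
      using S invariant by (intro S_unique) (auto simp: A.diff[symmetric])
    show "nrm x = max (nrm (S x)) (nrm (x - S x))" for x
      using max[OF S(1)[of x] S(2)[of x]] by simp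
    show "nrm (A (S x)) \<le> a * nrm (S x)" for x
      using a S by (intro N.opnorm_on_bound) (auto simp: A.zero)
    show "nrm (inv A (x - S x)) \<le> b * nrm (x - S x)" for x
      using b S B0 by (intro N.opnorm_on_bound) auto
    show "nrm (inv A x) \<le> KB * nrm x" for x
      using KB B0 by (intro N.opnorm_on_bound) auto
  qed (use A.add BA AB KA a b KB L aL bL KBL in auto)
  have "perturbation g"
    using bounded N.Lip_bound[OF L(2,1)] unfolding perturbation_def bounded_map_def bdd_above_def by auto
  then show ?thesis
    unfolding T_eq by (rule topological_conjugacy)
qed

end
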